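(* Let $f:\mathbb{R}^d\to\mathbb{R}$ be continuously differentiable, convex, and $L$-smooth for some $L>0$; suppose $f$ has a lower bound and attains its minimum $f^*=f(x^* )$ at a point $x^*\in\mathbb{R}^d$. Let $(\alpha_k)_{k\ge1}$ be positive step sizes with $\lim_{k\to\infty}\alpha_k=0$, $\sum_{k=1}^\infty\alpha_k=\infty$, and $$\alpha_n\sum_{k=1}^n\alpha_k^2\to0\quad\text{as } n\to\infty .$$ Let $x_0$ be an $\mathbb{R}^d$-valued random variable with $\mathbb{E}|f(x_0)|<\infty$, and let $(x_k)$ be generated by vanilla SGD, $x_k=x_{k-1}-\alpha_k\nabla f(x_{k-1})+\alpha_k\xi_k$ for $k\ge1$, where the $\mathbb{R}^d$-valued noise satisfies, for constants $M,V\ge0$ and all $k\ge1$, $$\mathbb{E}[\xi_k\mid\mathcal{F}_{k-1}]=0,\qquad \mathbb{E}[\|\xi_k\|^2\mid\mathcal{F}_{k-1}]\le M+V\|\nabla f(x_{k-1})\|^2 .$$ Then $$\lim_{n\to\infty}\mathbb{E} f(x_n)=f(x^* )=f^* .$$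
   Context: $\mathcal{F}_k=\sigma(x_0,\xi_1,\dots,\xi_k)$ is the filtration generated by the initial value and the noise. $f$ is $L$-smooth if $\|\nabla f(x)-\nabla f(y)\|\le L\|x-y\|$ for all $x,y\in\mathbb{R}^d$. *)

theory Defs
  imports "HOL-Probability.Probability"
begin

text \<open>The sigma-algebra generated by \<open>x0, \<xi> 1, \<dots>, \<xi> k\<close>. The noise is indexed from 1; the value
  \<open>\<xi> 0\<close> plays no role.\<close>

definition noise_filtration ::
  "'w measure \<Rightarrow> ('w \<Rightarrow> 'b::topological_space) \<Rightarrow> (nat \<Rightarrow> 'w \<Rightarrow> 'b) \<Rightarrow> nat \<Rightarrow> 'w measure" where
  "noise_filtration P x0 \<xi> k =
     sigma (space P)
       ({x0 -` A \<inter> space P | A. A \<in> sets borel} \<union>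
        (\<Union>i\<in>{1..k}. {\<xi> i -` A \<inter> space P | A. A \<in> sets borel}))"

text \<open>The library provides conditional expectations of real functions only, hence the componentwise
  definition. As with \<^const>\<open>real_cond_exp\<close>, it is meaningful for integrable \<open>X\<close>.\<close>

definition vec_cond_exp ::
  "'w measure \<Rightarrow> 'w measure \<Rightarrow> ('w \<Rightarrow> real ^ 'd) \<Rightarrow> 'w \<Rightarrow> real ^ 'd" where
  "vec_cond_exp P F X w = (\<chi> i. real_cond_exp P F (\<lambda>v. X v $ i) w)"

end

(* Write e k for the expected suboptimality of x k. If z is measurable with respect to the past of
time k, then the mean squared distance from z satisfies
  E|x (k+1) - z|^2 <= E|x k - z|^2 - 2 alpha (E f(x k) - E f(z)) + O(alpha^2).
Taking for z the minimizer (corrected where x 0 is large, as x 0 need not be square integrable)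
and using that the step sizes are not summable gives liminf e = 0. To control the last iterate,
start at a time m with e m small, and for n > m let p be the last time in {m..n} with e p <= e m.
With z = x p the distances stay below a multiple of the sum of the squared steps, so convexity,
(e k - e p)^2 <= E|grad f(x k)|^2 E|x k - x p|^2, and alpha n * (sum of squared steps) -> 0 show
that any noticeable gap e k - e p forces e to decrease. *)

theory Submission
  imports Defs
begin

section \<open>Smooth and convex functions\<close>

lemma GDERIV_along_line:
  assumes "\<And>y. GDERIV f y :> g y"
  shows "((\<lambda>t. f (a + t *\<^sub>R b)) has_real_derivative (g (a + t *\<^sub>R b) \<bullet> b)) (at t)"
proof -
  have "((\<lambda>t. a + t *\<^sub>R b) has_derivative (\<lambda>s. s *\<^sub>R b)) (at t)"
    by (auto intro!: derivative_eq_intros)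
  from has_derivative_compose[OF this assms[of "a + t *\<^sub>R b", unfolded gderiv_def]]
  show ?thesis
    unfolding has_field_derivative_def by (simp add: inner_commute mult_commute_abs)
qed

text \<open>On the segment from \<open>a\<close> to \<open>y\<close>, let \<open>\<phi>\<close> be
  \<open>f\<close> minus the linear term and the quadratic term of the claim. By Cauchy-Schwarz and
  the Lipschitz bound its derivative is nonpositive, so \<open>\<phi>\<close> does not increase
  between 0 and 1.\<close>

lemma smooth_upper_bound:
  assumes gradient: "\<And>y. GDERIV f y :> g y"
    and smooth: "\<And>y z. norm (g y - g z) \<le> L * norm (y - z)"
  shows "f y \<le> f a + g a \<bullet> (y - a) + L / 2 * (norm (y - a))\<^sup>2"
proof -
  define b where "b = y - a"
  define \<phi> where "\<phi> t = f (a + t *\<^sub>R b) - t * (g a \<bullet> b) - L / 2 * t\<^sup>2 * (norm b)\<^sup>2" for t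
  have "\<phi> 1 \<le> \<phi> 0"
  proof (rule DERIV_nonpos_imp_nonincreasing[of 0 1])
    fix t :: real assume "0 \<le> t" "t \<le> 1"
    have "(g (a + t *\<^sub>R b) - g a) \<bullet> b \<le> norm (g (a + t *\<^sub>R b) - g a) * norm b"
      by (rule norm_cauchy_schwarz)
    also have "\<dots> \<le> L * norm (a + t *\<^sub>R b - a) * norm b"
      by (intro mult_right_mono smooth) auto
    also have "\<dots> = L * t * (norm b)\<^sup>2"
      using \<open>0 \<le> t\<close> by (simp add: power2_eq_square)
    finally have "g (a + t *\<^sub>R b) \<bullet> b - g a \<bullet> b - L * t * (norm b)\<^sup>2 \<le> 0"
      by (simp add: inner_diff_left)
    moreover have "(\<phi> has_real_derivative
        (g (a + t *\<^sub>R b) \<bullet> b - g a \<bullet> b - L * t * (norm b)\<^sup>2)) (at t)"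
      unfolding \<phi>_def
      by (auto intro!: derivative_eq_intros GDERIV_along_line[OF gradient])
    ultimately show "\<exists>d. (\<phi> has_real_derivative d) (at t) \<and> d \<le> 0" by blast
  qed simp
  then show ?thesis by (simp add: \<phi>_def b_def)
qed

text \<open>A gradient step of length \<open>1 / L\<close> minimizes the quadratic upper model of
  \<open>f\<close> at \<open>a\<close> and lowers the model by the squared gradient norm over
  \<open>2 * L\<close>. The lower bound \<open>c\<close> limits this decrease.\<close>

lemma smooth_gradient_bound:
  assumes gradient: "\<And>y. GDERIV f y :> g y"
    and smooth: "\<And>y z. norm (g y - g z) \<le> L * norm (y - z)"
    and L: "L > 0" and lower: "\<And>y. c \<le> f y"
  shows "(norm (g a))\<^sup>2 \<le> 2 * L * (f a - c)"
proof -
  have "c \<le> f (a - (1 / L) *\<^sub>R g a)" by (rule lower)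
  also have "\<dots> \<le> f a + g a \<bullet> (a - (1 / L) *\<^sub>R g a - a)
      + L / 2 * (norm (a - (1 / L) *\<^sub>R g a - a))\<^sup>2"
    by (rule smooth_upper_bound[OF gradient smooth])
  also have "\<dots> = f a - (norm (g a))\<^sup>2 / (2 * L)"
    using L by (simp add: power2_norm_eq_inner[symmetric] field_simps power2_eq_square)
  finally show ?thesis using L by (simp add: field_simps)
qed

text \<open>Restricted to the line through \<open>a\<close> and \<open>y\<close>, this is the fact
  that a convex function of one real variable lies above its tangent at 0.\<close>

lemma convex_on_gradient:
  fixes f :: "'a::real_inner \<Rightarrow> real"
  assumes gradient: "\<And>y. GDERIV f y :> g y" and convex: "convex_on UNIV f"
  shows "f a - f y \<le> g a \<bullet> (a - y)"
proof -
  define \<phi> where "\<phi> t = f (a + t *\<^sub>R (y - a))" for t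
  have "convex_on UNIV \<phi>"
  proof (rule convex_onI)
    fix t r s :: real assume "0 < t" "t < 1"
    have "a + ((1 - t) *\<^sub>R r + t *\<^sub>R s) *\<^sub>R (y - a)
        = (1 - t) *\<^sub>R (a + r *\<^sub>R (y - a)) + t *\<^sub>R (a + s *\<^sub>R (y - a))"
      by (simp add: algebra_simps)
    then show "\<phi> ((1 - t) *\<^sub>R r + t *\<^sub>R s) \<le> (1 - t) * \<phi> r + t * \<phi> s"
      unfolding \<phi>_def using convex_onD[OF convex, of t] \<open>0 < t\<close> \<open>t < 1\<close> by simp
  qed simp
  moreover have "(\<phi> has_real_derivative (g a \<bullet> (y - a))) (at 0)"
    using GDERIV_along_line[OF gradient, of a "y - a" 0] by (simp add: \<phi>_def[abs_def])
  ultimately have "\<phi> 1 - \<phi> 0 \<ge> g a \<bullet> (y - a) * (1 - 0)"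
    by (intro convex_on_imp_above_tangent[of UNIV]) auto
  then show ?thesis by (simp add: \<phi>_def inner_diff_right)
qed

section \<open>Square-integrable random vectors\<close>

text \<open>Measurability of \<open>h\<close> is a separate conjunct, since integrability of the
  squared norm yields only measurability of that norm.\<close>

definition square_integrable :: "'w measure \<Rightarrow> ('w \<Rightarrow> 'b::euclidean_space) \<Rightarrow> bool" where
  "square_integrable P h \<longleftrightarrow> h \<in> borel_measurable P \<and> integrable P (\<lambda>w. (norm (h w))\<^sup>2)"

lemma square_integrable_measurable: "square_integrable P h \<Longrightarrow> h \<in> borel_measurable P"
  and square_integrable_norm: "square_integrable P h \<Longrightarrow> integrable P (\<lambda>w. (norm (h w))\<^sup>2)"
  by (auto simp: square_integrable_def)

lemma square_integrable_cong:
  "(\<And>w. w \<in> space P \<Longrightarrow> g w = h w) \<Longrightarrow> square_integrable P g \<longleftrightarrow> square_integrable P h"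
  unfolding square_integrable_def
  by (intro conj_cong measurable_cong Bochner_Integration.integrable_cong) auto

lemma square_integrable_bounded_norm:
  assumes "h \<in> borel_measurable P" "integrable P b" "\<And>w. w \<in> space P \<Longrightarrow> (norm (h w))\<^sup>2 \<le> b w"
  shows "square_integrable P h"
  unfolding square_integrable_def
proof
  note [measurable] = assms(1)
  show "integrable P (\<lambda>w. (norm (h w))\<^sup>2)"
  proof (rule Bochner_Integration.integrable_bound[OF assms(2)])
    show "AE w in P. norm ((norm (h w))\<^sup>2) \<le> norm (b w)"
      using assms(3) by (intro AE_I2) fastforce
  qed measurable
qed fact

lemma square_integrable_scaleR:
  assumes "square_integrable P h"
  shows "square_integrable P (\<lambda>w. c *\<^sub>R h w)"
  using assms unfolding square_integrable_def
  by (auto simp: power_mult_distrib intro!: borel_measurable_scaleR)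

lemma square_integrable_add:
  assumes "square_integrable P g" "square_integrable P h"
  shows "square_integrable P (\<lambda>w. g w + h w)"
proof (rule square_integrable_bounded_norm)
  show "(\<lambda>w. g w + h w) \<in> borel_measurable P"
    using assms by (intro borel_measurable_add square_integrable_measurable)
  show "integrable P (\<lambda>w. 2 * (norm (g w))\<^sup>2 + 2 * (norm (h w))\<^sup>2)"
    using assms by (simp add: square_integrable_def)
  fix w
  have "(norm (g w + h w))\<^sup>2 \<le> (norm (g w) + norm (h w))\<^sup>2"
    by (intro power_mono norm_triangle_ineq) auto
  also have "\<dots> \<le> 2 * (norm (g w))\<^sup>2 + 2 * (norm (h w))\<^sup>2"
    using sum_squares_bound[of "norm (g w)" "norm (h w)"] by (simp add: power2_sum)
  finally show "(norm (g w + h w))\<^sup>2 \<le> 2 * (norm (g w))\<^sup>2 + 2 * (norm (h w))\<^sup>2" .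
qed

lemma square_integrable_diff:
  assumes "square_integrable P g" "square_integrable P h"
  shows "square_integrable P (\<lambda>w. g w - h w)"
  using square_integrable_add[OF assms(1) square_integrable_scaleR[OF assms(2), of "-1"]] by simp

lemma square_integrable_norm_mult:
  assumes "square_integrable P g" "square_integrable P h"
  shows "integrable P (\<lambda>w. norm (g w) * norm (h w))"
proof (rule Bochner_Integration.integrable_bound)
  show "integrable P (\<lambda>w. (norm (g w))\<^sup>2 + (norm (h w))\<^sup>2)"
    using assms by (simp add: square_integrable_def)
  show "(\<lambda>w. norm (g w) * norm (h w)) \<in> borel_measurable P"
    using assms[THEN square_integrable_measurable, measurable] by measurable
  have "norm (g w) * norm (h w) \<le> (norm (g w))\<^sup>2 + (norm (h w))\<^sup>2" for w
    using sum_squares_bound[of "norm (g w)" "norm (h w)"]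
      mult_nonneg_nonneg[OF norm_ge_zero[of "g w"] norm_ge_zero[of "h w"]] by linarith
  then show "AE w in P. norm (norm (g w) * norm (h w)) \<le> norm ((norm (g w))\<^sup>2 + (norm (h w))\<^sup>2)"
    by (intro AE_I2) simp
qed

lemma square_integrable_inner:
  assumes "square_integrable P g" "square_integrable P h"
  shows "integrable P (\<lambda>w. g w \<bullet> h w)"
proof (rule Bochner_Integration.integrable_bound[OF square_integrable_norm_mult[OF assms]])
  show "(\<lambda>w. g w \<bullet> h w) \<in> borel_measurable P"
    using assms by (intro borel_measurable_inner square_integrable_measurable)
  show "AE w in P. norm (g w \<bullet> h w) \<le> norm (norm (g w) * norm (h w))"
    by (intro AE_I2) (simp add: Cauchy_Schwarz_ineq2)
qed

text \<open>The second moment of \<open>g - s h\<close> is a quadratic polynomial in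
  \<open>s\<close> that is never negative; a suitable choice of \<open>s\<close> gives the
  inequality.\<close>

lemma integral_inner_Cauchy_Schwarz:
  assumes g: "square_integrable P g" and h: "square_integrable P h"
  shows "(\<integral>w. g w \<bullet> h w \<partial>P)\<^sup>2 \<le> (\<integral>w. (norm (g w))\<^sup>2 \<partial>P) * (\<integral>w. (norm (h w))\<^sup>2 \<partial>P)"
proof -
  define A B C where "A = (\<integral>w. (norm (g w))\<^sup>2 \<partial>P)" and "B = (\<integral>w. g w \<bullet> h w \<partial>P)"
    and "C = (\<integral>w. (norm (h w))\<^sup>2 \<partial>P)"
  have quadratic: "0 \<le> A - 2 * s * B + s\<^sup>2 * C" for s
  proof -
    have "0 \<le> (\<integral>w. (norm (g w - s *\<^sub>R h w))\<^sup>2 \<partial>P)" by simp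
    also have "\<dots>
        = (\<integral>w. (norm (g w))\<^sup>2 - 2 * s * (g w \<bullet> h w) + s\<^sup>2 * (norm (h w))\<^sup>2 \<partial>P)"
      by (simp add: power2_norm_eq_inner inner_diff_left inner_diff_right inner_commute
          algebra_simps power2_eq_square[of s])
    also have "\<dots> = A - 2 * s * B + s\<^sup>2 * C"
      unfolding A_def B_def C_def
      using square_integrable_norm[OF g] square_integrable_norm[OF h] square_integrable_inner[OF g h]
      by simp
    finally show ?thesis .
  qed
  have "C \<ge> 0" unfolding C_def by simp
  have "B\<^sup>2 \<le> A * C"
  proof (cases "C = 0")
    case True
    have "B = 0"
    proof (rule ccontr)
      assume "B \<noteq> 0"
      \<comment> \<open>When \<open>C = 0\<close> the polynomial is affine in \<open>s\<close>; this
        \<open>s\<close> gives it the value -1.\<close>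
      then show False using quadratic[of "(A + 1) / (2 * B)"] True by simp
    qed
    then show ?thesis using True by simp
  next
    case False
    \<comment> \<open>The value \<open>B / C\<close> is the minimizer of the quadratic.\<close>
    then show ?thesis using quadratic[of "B / C"] \<open>C \<ge> 0\<close> by (simp add: field_simps power2_eq_square)
  qed
  then show ?thesis by (simp add: A_def B_def C_def)
qed

section \<open>The noise filtration\<close>

context
  fixes P :: "'w measure" and x0 :: "'w \<Rightarrow> 'b::topological_space" and \<xi> :: "nat \<Rightarrow> 'w \<Rightarrow> 'b"
begin

lemma noise_filtration_generators:
  "{x0 -` A \<inter> space P | A. A \<in> sets borel} \<union>
      (\<Union>i\<in>{1..k}. {\<xi> i -` A \<inter> space P | A. A \<in> sets borel}) \<subseteq> Pow (space P)"
  by auto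

lemma space_noise_filtration: "space (noise_filtration P x0 \<xi> k) = space P"
  unfolding noise_filtration_def by (rule space_measure_of[OF noise_filtration_generators])

lemma sets_noise_filtration:
  "sets (noise_filtration P x0 \<xi> k) = sigma_sets (space P)
     ({x0 -` A \<inter> space P | A. A \<in> sets borel} \<union>
        (\<Union>i\<in>{1..k}. {\<xi> i -` A \<inter> space P | A. A \<in> sets borel}))"
  unfolding noise_filtration_def by (rule sets_measure_of[OF noise_filtration_generators])

lemma initial_measurable_noise_filtration: "x0 \<in> borel_measurable (noise_filtration P x0 \<xi> k)"
  by (rule measurableI) (auto simp: sets_noise_filtration space_noise_filtration)

lemma noise_measurable_noise_filtration:
  "1 \<le> i \<Longrightarrow> i \<le> k \<Longrightarrow> \<xi> i \<in> borel_measurable (noise_filtration P x0 \<xi> k)"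
  by (rule measurableI)
    (auto simp: sets_noise_filtration space_noise_filtration intro!: sigma_sets.Basic)

lemma subalgebra_noise_filtration:
  assumes "x0 \<in> borel_measurable P" "\<And>i. 1 \<le> i \<Longrightarrow> \<xi> i \<in> borel_measurable P"
  shows "subalgebra P (noise_filtration P x0 \<xi> k)"
  unfolding subalgebra_def sets_noise_filtration
  using assms by (auto simp: space_noise_filtration intro!: sets.sigma_sets_subset)

lemma subalgebra_noise_filtration_mono:
  assumes "j \<le> k"
  shows "subalgebra (noise_filtration P x0 \<xi> k) (noise_filtration P x0 \<xi> j)"
  unfolding subalgebra_def sets_noise_filtration space_noise_filtration
  using assms by (intro conjI refl sigma_sets_mono' Un_mono UN_mono order_refl) auto

end

section \<open>The deterministic recursion\<close>

text \<open>The role of the sequences: \<open>e k\<close> is the expected suboptimality, \<open>G k\<close> the expected squared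
  gradient norm, and \<open>D p k\<close> and \<open>Q k\<close> are mean squared distances of the \<open>k\<close>-th iterate from the
  \<open>p\<close>-th iterate and from an almost optimal reference point.\<close>

locale sgd_recursion =
  fixes e G \<alpha> :: "nat \<Rightarrow> real" and D :: "nat \<Rightarrow> nat \<Rightarrow> real" and L M V :: real
  assumes L_pos: "L > 0" and M_nonneg: "M \<ge> 0" and V_nonneg: "V \<ge> 0"
    and step_pos: "\<And>k. k \<ge> 1 \<Longrightarrow> \<alpha> k > 0"
    and step_null: "\<alpha> \<longlonglongrightarrow> 0"
    and step_diverges: "filterlim (\<lambda>n. \<Sum>k=1..n. \<alpha> k) at_top sequentially"
    and step_squares: "(\<lambda>n. \<alpha> n * (\<Sum>k=1..n. (\<alpha> k)\<^sup>2)) \<longlonglongrightarrow> 0"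
    and e_nonneg: "\<And>k. 0 \<le> e k"
    and G_nonneg: "\<And>k. 0 \<le> G k"
    and G_le: "\<And>k. G k \<le> 2 * L * e k"
    and descent: "\<And>k. e (Suc k) \<le> e k - \<alpha> (Suc k) * G k
        + L / 2 * (\<alpha> (Suc k))\<^sup>2 * ((1 + V) * G k + M)"
    and D_diag: "\<And>p. D p p = 0"
    and D_step: "\<And>p k. p \<le> k \<Longrightarrow> D p (Suc k) \<le> D p k - 2 * \<alpha> (Suc k) * (e k - e p)
        + (\<alpha> (Suc k))\<^sup>2 * ((1 + V) * G k + M)"
    and gap_le: "\<And>p k. p \<le> k \<Longrightarrow> e p \<le> e k \<Longrightarrow> (e k - e p)\<^sup>2 \<le> G k * D p k"
    and almost_optimal: "\<And>\<epsilon>. \<epsilon> > 0 \<Longrightarrow> \<exists>Q. (\<forall>k. 0 \<le> Q k) \<and>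
        (\<forall>k. Q (Suc k) \<le> Q k - 2 * \<alpha> (Suc k) * (e k - \<epsilon>)
          + (\<alpha> (Suc k))\<^sup>2 * ((1 + V) * G k + M))"
begin

lemma step_pos_Suc: "\<alpha> (Suc k) > 0"
  using step_pos by simp

lemma eventually_step_le:
  assumes "c > 0"
  shows "eventually (\<lambda>k. K * \<alpha> (Suc k) \<le> c) sequentially"
proof -
  have "(\<lambda>k. K * \<alpha> (Suc k)) \<longlonglongrightarrow> K * 0"
    by (intro tendsto_mult_left LIMSEQ_Suc[OF step_null])
  then have "eventually (\<lambda>k. K * \<alpha> (Suc k) < c) sequentially"
    using assms by (intro order_tendstoD(2)) auto
  then show ?thesis by eventually_elim simp
qed

lemma noise_term_le: "(1 + V) * G k + M \<le> 2 * L * (1 + V) * e k + M"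
  using mult_left_mono[OF G_le[of k], of "1 + V"] V_nonneg by (simp add: algebra_simps)

text \<open>If \<open>e\<close> stayed above \<open>2 * \<epsilon>\<close>, the drift would dominate
  the noise and \<open>Q\<close> would lose a fixed multiple of each step size. As the step sizes
  are not summable, \<open>Q\<close> would become negative.\<close>

lemma frequently_small:
  assumes "\<epsilon> > 0"
  shows "\<exists>m\<ge>N. e m \<le> 2 * \<epsilon>"
proof (rule ccontr)
  assume "\<not> (\<exists>m\<ge>N. e m \<le> 2 * \<epsilon>)"
  then have large: "e k > 2 * \<epsilon>" if "k \<ge> N" for k
    using that by force
  obtain Q where Q_nonneg: "0 \<le> Q k"
    and Q_step: "Q (Suc k) \<le> Q k - 2 * \<alpha> (Suc k) * (e k - \<epsilon>)
      + (\<alpha> (Suc k))\<^sup>2 * ((1 + V) * G k + M)" for k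
    using almost_optimal[OF assms] by blast
  \<comment> \<open>With these thresholds the noise costs at most
    \<open>e k / 2 + \<epsilon> / 2\<close> per unit of step size. Against the drift
    \<open>2 * (e k - \<epsilon>)\<close> and with \<open>e k > 2 * \<epsilon>\<close>, a net loss
    of at least \<open>\<epsilon> / 2\<close> remains.\<close>
  have "eventually (\<lambda>k. 2 * L * (1 + V) * \<alpha> (Suc k) \<le> 1 / 2 \<and> M * \<alpha> (Suc k) \<le> \<epsilon> / 2) sequentially"
    using assms by (intro eventually_conj eventually_step_le) auto
  then obtain N0 where N0: "2 * L * (1 + V) * \<alpha> (Suc k) \<le> 1 / 2" "M * \<alpha> (Suc k) \<le> \<epsilon> / 2"
    if "k \<ge> N0" for k
    by (auto simp: eventually_sequentially)
  define N' where "N' = max N N0"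
  have decrease: "Q (Suc k) \<le> Q k - \<epsilon> / 2 * \<alpha> (Suc k)" if "k \<ge> N'" for k
  proof -
    have k: "k \<ge> N" "k \<ge> N0" using that by (auto simp: N'_def)
    have "\<alpha> (Suc k) * ((1 + V) * G k + M) \<le> \<alpha> (Suc k) * (2 * L * (1 + V) * e k + M)"
      using noise_term_le step_pos_Suc[of k] by (intro mult_left_mono) auto
    also have "\<dots> = (2 * L * (1 + V) * \<alpha> (Suc k)) * e k + M * \<alpha> (Suc k)"
      by (simp add: algebra_simps)
    also have "\<dots> \<le> 1 / 2 * e k + \<epsilon> / 2"
      using N0[OF k(2)] e_nonneg[of k] by (intro add_mono mult_right_mono) auto
    finally have "\<alpha> (Suc k) * ((1 + V) * G k + M) - 2 * (e k - \<epsilon>) \<le> - (\<epsilon> / 2)"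
      using large[OF k(1)] by simp
    then have "\<alpha> (Suc k) * (\<alpha> (Suc k) * ((1 + V) * G k + M) - 2 * (e k - \<epsilon>))
        \<le> \<alpha> (Suc k) * (- (\<epsilon> / 2))"
      using step_pos_Suc[of k] by (intro mult_left_mono) auto
    then show ?thesis
      using Q_step[of k] by (simp add: algebra_simps power2_eq_square)
  qed
  have telescoped: "Q k \<le> Q N' - \<epsilon> / 2 * ((\<Sum>j=1..k. \<alpha> j) - (\<Sum>j=1..N'. \<alpha> j))" if "k \<ge> N'" for k
    using that
  proof (induction k rule: dec_induct)
    case (step k)
    then show ?case using decrease[of k] by (simp add: algebra_simps)
  qed simp
  \<comment> \<open>The offset is chosen so that the telescoped loss exceeds
    \<open>Q N'\<close>.\<close>
  have "eventually (\<lambda>k. (\<Sum>j=1..k. \<alpha> j) > (\<Sum>j=1..N'. \<alpha> j) + 2 * Q N' / \<epsilon>) sequentially"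
    using step_diverges by (simp add: filterlim_at_top_dense)
  then have "eventually (\<lambda>k. k \<ge> N' \<and> (\<Sum>j=1..k. \<alpha> j) > (\<Sum>j=1..N'. \<alpha> j) + 2 * Q N' / \<epsilon>) sequentially"
    by (intro eventually_conj eventually_ge_at_top)
  then obtain k where k: "k \<ge> N'" "(\<Sum>j=1..k. \<alpha> j) - (\<Sum>j=1..N'. \<alpha> j) > 2 * Q N' / \<epsilon>"
    by (force simp: eventually_sequentially)
  have "\<epsilon> / 2 * ((\<Sum>j=1..k. \<alpha> j) - (\<Sum>j=1..N'. \<alpha> j)) > \<epsilon> / 2 * (2 * Q N' / \<epsilon>)"
    using k(2) assms by (intro mult_strict_left_mono) auto
  also have "\<epsilon> / 2 * (2 * Q N' / \<epsilon>) = Q N'" using assms by simp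
  finally show False using telescoped[OF k(1)] Q_nonneg[of k] by linarith
qed

text \<open>Between the last visit \<open>p\<close> below the level \<open>B\<close> and the time \<open>n\<close>, the iterates do not get
  better than the \<open>p\<close>-th one, so \<open>D p k\<close> grows at most like the sum of the squared steps. By convexity
  a gap \<open>e k - e p > \<eta> / 2\<close> then forces the gradient to be so large that the deterministic decrease
  dominates the noise.\<close>

lemma excursion_small:
  assumes "e p \<le> B" "B \<le> 1" "\<eta> > 0" and above: "\<And>k. p < k \<Longrightarrow> k \<le> n \<Longrightarrow> B < e k"
    and step1: "\<And>k. p \<le> k \<Longrightarrow> 2 * L * (1 + V) * \<alpha> (Suc k) \<le> 1"
    and step2: "\<And>k. p \<le> k \<Longrightarrow> L * M * (\<alpha> (Suc k))\<^sup>2 \<le> \<eta>"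
    and step3: "\<And>k. p \<le> k \<Longrightarrow>
      4 * L * M * (2 * L * (1 + V) + M) * (\<alpha> (Suc k) * (\<Sum>j=1..k. (\<alpha> j)\<^sup>2)) \<le> \<eta>\<^sup>2"
    and "p \<le> k" "k \<le> n"
  shows "D p k \<le> (2 * L * (1 + V) + M) * (\<Sum>j=1..k. (\<alpha> j)\<^sup>2) \<and> e k \<le> e p + \<eta>"
  using \<open>p \<le> k\<close> \<open>k \<le> n\<close>
proof (induction k rule: dec_induct)
  case base
  then show ?case
    using L_pos M_nonneg V_nonneg \<open>\<eta> > 0\<close> by (auto simp: D_diag intro!: mult_nonneg_nonneg sum_nonneg)
next
  case (step k)
  define C where "C = 2 * L * (1 + V) + M"
  define a where "a = \<alpha> (Suc k)"
  define \<sigma> where "\<sigma> = (\<Sum>j=1..k. (\<alpha> j)\<^sup>2)"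
  have "a > 0" unfolding a_def by (rule step_pos_Suc)
  have IH: "D p k \<le> C * \<sigma>" "e k \<le> e p + \<eta>"
    using step by (auto simp: C_def \<sigma>_def)
  have "e p \<le> e k"
    using above[of k] step \<open>e p \<le> B\<close> by (cases "k = p") auto
  have "e p \<le> 1" using \<open>e p \<le> B\<close> \<open>B \<le> 1\<close> by simp
  have a1: "2 * L * (1 + V) * a \<le> 1" using step1[OF step(1)] by (simp add: a_def)
  have "2 * L * (1 + V) * a \<ge> 0" using L_pos V_nonneg \<open>a > 0\<close> by simp

  \<comment> \<open>Split \<open>e k\<close> into \<open>e k - e p\<close> and \<open>e p\<close>.
    The first part of the noise is absorbed by half of the drift \<open>2 * a * (e k - e p)\<close>;
    the second is bounded using \<open>e p \<le> 1\<close>, leaving only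
    \<open>C * a\<^sup>2\<close> to be added to the distance.\<close>
  have "a * ((1 + V) * G k + M) \<le> a * (2 * L * (1 + V) * e k + M)"
    using \<open>a > 0\<close> noise_term_le by (intro mult_left_mono) auto
  also have "\<dots> = (2 * L * (1 + V) * a) * (e k - e p) + a * (2 * L * (1 + V) * e p + M)"
    by (simp add: algebra_simps)
  also have "\<dots> \<le> 1 * (e k - e p) + a * (2 * L * (1 + V) * 1 + M)"
    using a1 \<open>e p \<le> e k\<close> \<open>e p \<le> 1\<close> \<open>a > 0\<close> L_pos V_nonneg
    by (intro add_mono mult_right_mono mult_left_mono) auto
  finally have "a * (a * ((1 + V) * G k + M)) \<le> a * (1 * (e k - e p) + a * C)"
    using \<open>a > 0\<close> unfolding C_def by (intro mult_left_mono) auto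
  then have "a\<^sup>2 * ((1 + V) * G k + M) \<le> a * (e k - e p) + a\<^sup>2 * C"
    by (simp add: algebra_simps power2_eq_square)
  moreover have "a * (e k - e p) \<ge> 0" using \<open>a > 0\<close> \<open>e p \<le> e k\<close> by simp
  ultimately have "D p (Suc k) \<le> C * \<sigma> + a\<^sup>2 * C"
    using D_step[OF step(1)] IH(1) unfolding a_def[symmetric] by simp
  then have D: "D p (Suc k) \<le> C * (\<Sum>j=1..Suc k. (\<alpha> j)\<^sup>2)"
    by (simp add: \<sigma>_def a_def algebra_simps)

  \<comment> \<open>For small \<open>a\<close> the gradient part of the noise costs at most a
    quarter of \<open>a * G k\<close>, so half of the decrease \<open>a * G k\<close> certainly
    survives.\<close>
  have "a * G k \<ge> 0" using \<open>a > 0\<close> G_nonneg[of k] by simp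
  have "(L * (1 + V) * a) * (a * G k) \<le> 1 / 2 * (a * G k)"
    using a1 \<open>a * G k \<ge> 0\<close> by (intro mult_right_mono) auto
  moreover have "L / 2 * a\<^sup>2 * ((1 + V) * G k + M)
      = (L * (1 + V) * a) * (a * G k) / 2 + L * M * a\<^sup>2 / 2"
    by (simp add: algebra_simps power2_eq_square add_divide_distrib)
  ultimately have decrease: "e (Suc k) \<le> e k - a * G k / 2 + L * M * a\<^sup>2 / 2"
    using descent[of k] \<open>a * G k \<ge> 0\<close>
    unfolding a_def[symmetric] by linarith
  have "e (Suc k) \<le> e p + \<eta>"
  \<comment> \<open>After a small gap one step can raise \<open>e\<close> by at most
    \<open>\<eta> / 2\<close>. After a large gap it does not raise \<open>e\<close> at all, because
    the gradient term outweighs \<open>L * M * a\<^sup>2\<close>.\<close>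
  proof (cases "e k - e p \<le> \<eta> / 2")
    case True
    then show ?thesis
      using \<open>a * G k \<ge> 0\<close> decrease step2[OF step(1)] by (simp add: a_def)
  next
    case False
    \<comment> \<open>With a smaller gradient, the inequality \<open>gap_le\<close> and the bound on
      the distance would force the squared gap below \<open>\<eta>\<^sup>2 / 4\<close>; this is
      where the hypothesis on the step size times the sum of squared steps enters.\<close>
    have "G k \<ge> L * M * a"
    proof (rule ccontr)
      assume "\<not> G k \<ge> L * M * a"
      have "0 \<le> C * \<sigma>"
        using L_pos M_nonneg V_nonneg
        by (auto simp: C_def \<sigma>_def intro!: mult_nonneg_nonneg sum_nonneg)
      have "\<eta>\<^sup>2 / 4 = (\<eta> / 2)\<^sup>2" by (simp add: power_divide)
      also have "\<dots> < (e k - e p)\<^sup>2"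
        using False \<open>\<eta> > 0\<close> by (intro power_strict_mono) auto
      also have "\<dots> \<le> G k * D p k" by (rule gap_le[OF step(1) \<open>e p \<le> e k\<close>])
      also have "\<dots> \<le> G k * (C * \<sigma>)"
        using IH(1) G_nonneg by (intro mult_left_mono)
      also have "\<dots> \<le> L * M * a * (C * \<sigma>)"
        using \<open>\<not> G k \<ge> L * M * a\<close> \<open>0 \<le> C * \<sigma>\<close> by (intro mult_right_mono) auto
      also have "\<dots> \<le> \<eta>\<^sup>2 / 4"
        using step3[OF step(1)] by (simp add: C_def \<sigma>_def a_def algebra_simps)
      finally show False by simp
    qed
    then have "a * G k \<ge> a * (L * M * a)"
      using \<open>a > 0\<close> by (intro mult_left_mono) auto
    then show ?thesis
      using decrease IH(2) by (simp add: power2_eq_square algebra_simps)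
  qed
  with D show ?case by (simp add: C_def)
qed

text \<open>The excursion estimate is applied from the last time in \<open>{m..n}\<close> at which
  \<open>e\<close> is at most \<open>B\<close>. Such a time exists because \<open>m\<close> itself
  qualifies, and by maximality \<open>e\<close> exceeds \<open>B\<close> afterwards.\<close>

lemma stays_small:
  assumes "e m \<le> B" "B \<le> 1" "\<eta> > 0" "m \<le> n"
    and "\<And>k. m \<le> k \<Longrightarrow> 2 * L * (1 + V) * \<alpha> (Suc k) \<le> 1"
    and "\<And>k. m \<le> k \<Longrightarrow> L * M * (\<alpha> (Suc k))\<^sup>2 \<le> \<eta>"
    and "\<And>k. m \<le> k \<Longrightarrow>
      4 * L * M * (2 * L * (1 + V) + M) * (\<alpha> (Suc k) * (\<Sum>j=1..k. (\<alpha> j)\<^sup>2)) \<le> \<eta>\<^sup>2"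
  shows "e n \<le> B + \<eta>"
proof -
  define S where "S = {k \<in> {m..n}. e k \<le> B}"
  have "finite S" "S \<noteq> {}" using assms by (auto simp: S_def)
  have above: "k \<notin> S" if "Max S < k" for k
    using that Max_ge[OF \<open>finite S\<close>, of k] by force
  have "Max S \<in> S" using \<open>finite S\<close> \<open>S \<noteq> {}\<close> by (rule Max_in)
  then have p: "m \<le> Max S" "Max S \<le> n" "e (Max S) \<le> B" by (auto simp: S_def)
  have "e n \<le> e (Max S) + \<eta>"
  proof (rule conjunct2[OF excursion_small[where B = B and n = n]])
    fix k assume "Max S < k" "k \<le> n"
    then show "B < e k" using above[of k] p(1) by (auto simp: S_def)
  qed (use assms p in auto)
  with p(3) show ?thesis by simp
qed

theorem suboptimality_tendsto_0: "e \<longlonglongrightarrow> 0"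
proof (rule LIMSEQ_I)
  fix r :: real assume "r > 0"
  \<comment> \<open>\<open>\<eta>\<close> serves both as the level \<open>B\<close>, which must be
    at most 1, and as the allowed overshoot; their sum has to stay below \<open>r\<close>.\<close>
  define \<eta> where "\<eta> = min 1 r / 3"
  have \<eta>: "\<eta> > 0" "\<eta> \<le> 1" "3 * \<eta> \<le> r"
    using \<open>r > 0\<close> by (auto simp: \<eta>_def)
  define c where "c = 4 * L * M * (2 * L * (1 + V) + M)"
  have "c \<ge> 0" using L_pos M_nonneg V_nonneg by (simp add: c_def)
  have "(\<lambda>k. c * (\<alpha> (Suc k) * (\<Sum>j=1..Suc k. (\<alpha> j)\<^sup>2))) \<longlonglongrightarrow> c * 0"
    by (intro tendsto_mult_left LIMSEQ_Suc[OF step_squares])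
  then have ev3: "eventually (\<lambda>k. c * (\<alpha> (Suc k) * (\<Sum>j=1..Suc k. (\<alpha> j)\<^sup>2)) < \<eta>\<^sup>2) sequentially"
    using \<eta>(1) by (intro order_tendstoD(2)) auto
  have "(\<lambda>k. L * M * (\<alpha> (Suc k))\<^sup>2) \<longlonglongrightarrow> L * M * 0\<^sup>2"
    by (intro tendsto_mult_left tendsto_power LIMSEQ_Suc[OF step_null])
  then have ev2: "eventually (\<lambda>k. L * M * (\<alpha> (Suc k))\<^sup>2 < \<eta>) sequentially"
    using \<eta>(1) by (intro order_tendstoD(2)) auto
  have "eventually (\<lambda>k. 2 * L * (1 + V) * \<alpha> (Suc k) \<le> 1 \<and> L * M * (\<alpha> (Suc k))\<^sup>2 < \<eta> \<and>
      c * (\<alpha> (Suc k) * (\<Sum>j=1..Suc k. (\<alpha> j)\<^sup>2)) < \<eta>\<^sup>2) sequentially"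
    by (intro eventually_conj eventually_step_le ev2 ev3) simp
  then obtain N where N: "2 * L * (1 + V) * \<alpha> (Suc k) \<le> 1" "L * M * (\<alpha> (Suc k))\<^sup>2 < \<eta>"
    "c * (\<alpha> (Suc k) * (\<Sum>j=1..Suc k. (\<alpha> j)\<^sup>2)) < \<eta>\<^sup>2" if "k \<ge> N" for k
    by (auto simp: eventually_sequentially)
  \<comment> \<open>The assumption on the step sizes includes the newest square, whereas the
    excursion estimate stops one index earlier; the extra summand is nonnegative.\<close>
  have N3: "c * (\<alpha> (Suc k) * (\<Sum>j=1..k. (\<alpha> j)\<^sup>2)) \<le> \<eta>\<^sup>2" if "k \<ge> N" for k
  proof -
    have "c * (\<alpha> (Suc k) * (\<Sum>j=1..k. (\<alpha> j)\<^sup>2)) \<le> c * (\<alpha> (Suc k) * (\<Sum>j=1..Suc k. (\<alpha> j)\<^sup>2))"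
      using \<open>c \<ge> 0\<close> step_pos_Suc[of k] by (intro mult_left_mono) auto
    with N(3)[OF that] show ?thesis by simp
  qed
  obtain m where m: "m \<ge> N" "e m \<le> \<eta>"
    using frequently_small[of "\<eta> / 2" N] \<eta>(1) by auto
  have "norm (e n - 0) < r" if "n \<ge> m" for n
  proof -
    have "e n \<le> \<eta> + \<eta>"
      using m \<eta> that
      by (intro stays_small[of m] N(1) less_imp_le[OF N(2)] N3[unfolded c_def]) linarith+
    then show ?thesis using \<eta> e_nonneg[of n] by simp
  qed
  then show "\<exists>n0. \<forall>n\<ge>n0. norm (e n - 0) < r" by blast
qed

end

section \<open>Stochastic gradient descent\<close>

locale convex_sgd = prob_space P for P :: "'w measure" +
  fixes f :: "real ^ 'd \<Rightarrow> real" and grad_f :: "real ^ 'd \<Rightarrow> real ^ 'd" and xstar :: "real ^ 'd"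
    and L M V :: real and \<alpha> :: "nat \<Rightarrow> real" and x \<xi> :: "nat \<Rightarrow> 'w \<Rightarrow> real ^ 'd"
  assumes gradient: "\<And>y. GDERIV f y :> grad_f y"
    and grad_cont: "continuous_on UNIV grad_f"
    and convex: "convex_on UNIV f"
    and L_pos: "L > 0"
    and L_smooth: "\<And>y z. norm (grad_f y - grad_f z) \<le> L * norm (y - z)"
    and minimizer: "\<And>y. f xstar \<le> f y"
    and step_nonneg: "\<And>k. \<alpha> (Suc k) \<ge> 0"
    and x0_rv: "x 0 \<in> borel_measurable P"
    and x0_integrable: "integrable P (\<lambda>w. f (x 0 w))"
    and noise_rv: "\<And>k. k \<ge> 1 \<Longrightarrow> \<xi> k \<in> borel_measurable P"
    and sgd: "\<And>k w. w \<in> space P \<Longrightarrow>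
        x (Suc k) w = x k w - \<alpha> (Suc k) *\<^sub>R grad_f (x k w) + \<alpha> (Suc k) *\<^sub>R \<xi> (Suc k) w"
    and M_nonneg: "M \<ge> 0"
    and V_nonneg: "V \<ge> 0"
    and noise_mean: "\<And>k.
        AE w in P. vec_cond_exp P (noise_filtration P (x 0) \<xi> k) (\<xi> (Suc k)) w = 0"
    and noise_second_moment: "\<And>k.
        AE w in P. nn_cond_exp P (noise_filtration P (x 0) \<xi> k)
            (\<lambda>v. ennreal ((norm (\<xi> (Suc k) v))\<^sup>2)) w
          \<le> ennreal (M + V * (norm (grad_f (x k w)))\<^sup>2)"
begin

abbreviation F :: "nat \<Rightarrow> 'w measure" where
  "F \<equiv> noise_filtration P (x 0) \<xi>"

abbreviation g :: "nat \<Rightarrow> 'w \<Rightarrow> real ^ 'd" where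
  "g k w \<equiv> grad_f (x k w)"

abbreviation G :: "nat \<Rightarrow> real" where
  "G k \<equiv> expectation (\<lambda>w. (norm (g k w))\<^sup>2)"

section \<open>Adaptedness of the iterates to the noise filtration\<close>

lemma subalgebra_F: "subalgebra P (F k)"
  using x0_rv noise_rv by (intro subalgebra_noise_filtration) auto

sublocale F: finite_measure_subalgebra P "F k" for k
  by unfold_locales (rule subalgebra_F)

lemma f_measurable [measurable]: "f \<in> borel_measurable borel"
proof (rule borel_measurable_continuous_onI)
  show "continuous_on UNIV f"
    using gradient unfolding gderiv_def
    by (intro continuous_at_imp_continuous_on ballI) (blast intro: has_derivative_continuous)
qed

lemma grad_f_measurable [measurable]: "grad_f \<in> borel_measurable borel"
  by (rule borel_measurable_continuous_onI[OF grad_cont])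

lemma measurable_F_mono:
  assumes "h \<in> borel_measurable (F j)" "j \<le> k"
  shows "h \<in> borel_measurable (F k)"
  by (rule measurable_from_subalg[OF subalgebra_noise_filtration_mono[OF assms(2)] assms(1)])

lemma x_measurable_F: "x k \<in> borel_measurable (F k)"
proof (induction k)
  case 0
  show ?case by (rule initial_measurable_noise_filtration)
next
  case (Suc k)
  have [measurable]: "x k \<in> borel_measurable (F (Suc k))"
    by (rule measurable_F_mono[OF Suc]) simp
  have [measurable]: "\<xi> (Suc k) \<in> borel_measurable (F (Suc k))"
    by (rule noise_measurable_noise_filtration) auto
  have "(\<lambda>w. x k w - \<alpha> (Suc k) *\<^sub>R g k w + \<alpha> (Suc k) *\<^sub>R \<xi> (Suc k) w)
      \<in> borel_measurable (F (Suc k))"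
    by measurable
  then show ?case
    using measurable_cong[of "F (Suc k)" "x (Suc k)"] by (simp add: space_noise_filtration sgd)
qed

lemma g_measurable_F: "g k \<in> borel_measurable (F k)"
  using x_measurable_F by measurable

lemma x_measurable [measurable]: "x k \<in> borel_measurable P"
  by (rule measurable_from_subalg[OF subalgebra_F x_measurable_F])

lemma noise_measurable [measurable]: "\<xi> (Suc k) \<in> borel_measurable P"
  by (rule noise_rv) simp

text \<open>In each coordinate the factor \<open>h\<close>, known at time \<open>k\<close>, can be
  taken out of the conditional expectation of the noise, which vanishes. Square integrability makes
  the products integrable.\<close>

lemma noise_orthogonal:
  assumes hF: "h \<in> borel_measurable (F k)" and h: "square_integrable P h"
    and \<xi>: "square_integrable P (\<xi> (Suc k))"
  shows "expectation (\<lambda>w. h w \<bullet> \<xi> (Suc k) w) = 0"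
proof -
  have [measurable]: "(\<lambda>y. y $ i) \<in> borel_measurable borel" for i :: 'd
    by (intro borel_measurable_continuous_onI continuous_intros)
  have [measurable]: "h \<in> borel_measurable P"
    using h by (rule square_integrable_measurable)
  have component: "integrable P (\<lambda>w. h w $ i * \<xi> (Suc k) w $ i)" for i
  proof (rule Bochner_Integration.integrable_bound[OF square_integrable_norm_mult[OF h \<xi>]])
    show "AE w in P. norm (h w $ i * \<xi> (Suc k) w $ i) \<le> norm (norm (h w) * norm (\<xi> (Suc k) w))"
      by (intro AE_I2) (simp add: abs_mult mult_mono component_le_norm_cart)
  qed measurable
  have "expectation (\<lambda>w. h w $ i * \<xi> (Suc k) w $ i) = 0" for i
  proof -
    have [measurable]: "(\<lambda>w. h w $ i) \<in> borel_measurable (F k)"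
      using hF by measurable
    have "expectation (\<lambda>w. h w $ i * \<xi> (Suc k) w $ i)
        = expectation (\<lambda>w. h w $ i * real_cond_exp P (F k) (\<lambda>v. \<xi> (Suc k) v $ i) w)"
      by (rule F.real_cond_exp_intg(2)[OF component, symmetric]) measurable
    also have "\<dots> = expectation (\<lambda>w. 0)"
    proof (rule integral_cong_AE)
      show "AE w in P. h w $ i * real_cond_exp P (F k) (\<lambda>v. \<xi> (Suc k) v $ i) w = 0"
        using noise_mean[of k]
      proof eventually_elim
        case (elim w)
        then have "vec_cond_exp P (F k) (\<xi> (Suc k)) w $ i = 0" by simp
        then show ?case by (simp add: vec_cond_exp_def)
      qed
    qed measurable
    finally show ?thesis by simp
  qed
  then show ?thesis
    using component by (simp add: inner_vec_def)
qed

text \<open>Integrating the conditional bound as a nonnegative integral first shows that the second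
  moment is finite; only then can it be read as a real expectation.\<close>

lemma noise_moment:
  assumes "square_integrable P (g k)"
  shows "square_integrable P (\<xi> (Suc k))"
    and "expectation (\<lambda>w. (norm (\<xi> (Suc k) w))\<^sup>2) \<le> M + V * G k"
proof -
  have int: "integrable P (\<lambda>w. M + V * (norm (g k w))\<^sup>2)"
    using square_integrable_norm[OF assms] by simp
  have expect: "expectation (\<lambda>w. M + V * (norm (g k w))\<^sup>2) = M + V * G k"
    using square_integrable_norm[OF assms] by (simp add: prob_space)
  have "(\<integral>\<^sup>+ w. ennreal ((norm (\<xi> (Suc k) w))\<^sup>2) \<partial>P)
      = (\<integral>\<^sup>+ w. 1 * nn_cond_exp P (F k) (\<lambda>v. ennreal ((norm (\<xi> (Suc k) v))\<^sup>2)) w \<partial>P)"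
    by (subst F.nn_cond_exp_intg) auto
  also have "\<dots> \<le> (\<integral>\<^sup>+ w. ennreal (M + V * (norm (g k w))\<^sup>2) \<partial>P)"
    using noise_second_moment[of k] by (intro nn_integral_mono_AE) simp
  also have "\<dots> = ennreal (M + V * G k)"
    using int M_nonneg V_nonneg by (subst nn_integral_eq_integral) (auto simp: expect)
  finally have bound: "(\<integral>\<^sup>+ w. ennreal ((norm (\<xi> (Suc k) w))\<^sup>2) \<partial>P) \<le> ennreal (M + V * G k)" .
  have "integrable P (\<lambda>w. (norm (\<xi> (Suc k) w))\<^sup>2)"
  proof (rule integrableI_bounded)
    show "(\<integral>\<^sup>+ w. ennreal (norm ((norm (\<xi> (Suc k) w))\<^sup>2)) \<partial>P) < \<infinity>"
      using bound by (simp add: order.strict_trans1)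
  qed measurable
  then show "square_integrable P (\<xi> (Suc k))"
    by (simp add: square_integrable_def)
  have "0 \<le> M + V * G k" using M_nonneg V_nonneg by simp
  then show "expectation (\<lambda>w. (norm (\<xi> (Suc k) w))\<^sup>2) \<le> M + V * G k"
    using bound \<open>integrable P (\<lambda>w. (norm (\<xi> (Suc k) w))\<^sup>2)\<close>
    by (subst (asm) nn_integral_eq_integral) (auto simp: ennreal_le_iff)
qed

text \<open>Smoothness bounds the squared gradient by the suboptimality, so an integrable function
  value suffices and no moment of \<open>x k\<close> itself is required.\<close>

lemma gradient_square_integrable:
  assumes "integrable P (\<lambda>w. f (x k w))"
  shows "square_integrable P (g k)"
proof (rule square_integrable_bounded_norm)
  show "integrable P (\<lambda>w. 2 * L * (f (x k w) - f xstar))" using assms by simp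
  show "g k \<in> borel_measurable P" by measurable
qed (rule smooth_gradient_bound[OF gradient L_smooth L_pos minimizer])

text \<open>The gradient is known at time \<open>k\<close>, hence orthogonal to the noise, and the
  second moments add up.\<close>

lemma increment_moment:
  assumes g: "square_integrable P (g k)"
  shows "square_integrable P (\<lambda>w. \<xi> (Suc k) w - g k w)"
    and "expectation (\<lambda>w. (norm (\<xi> (Suc k) w - g k w))\<^sup>2) \<le> (1 + V) * G k + M"
proof -
  note \<xi> = noise_moment[OF g]
  show "square_integrable P (\<lambda>w. \<xi> (Suc k) w - g k w)"
    by (rule square_integrable_diff[OF \<xi>(1) g])
  have "expectation (\<lambda>w. (norm (\<xi> (Suc k) w - g k w))\<^sup>2)
      = expectation (\<lambda>w. (norm (\<xi> (Suc k) w))\<^sup>2 - 2 * (g k w \<bullet> \<xi> (Suc k) w) + (norm (g k w))\<^sup>2)"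
    by (simp add: power2_norm_eq_inner inner_diff_left inner_diff_right inner_commute algebra_simps)
  also have "\<dots> = expectation (\<lambda>w. (norm (\<xi> (Suc k) w))\<^sup>2) + G k"
    using square_integrable_norm[OF \<xi>(1)] square_integrable_norm[OF g]
      square_integrable_inner[OF g \<xi>(1)] noise_orthogonal[OF g_measurable_F g \<xi>(1)]
    by simp
  finally show "expectation (\<lambda>w. (norm (\<xi> (Suc k) w - g k w))\<^sup>2) \<le> (1 + V) * G k + M"
    using \<xi>(2) by (simp add: algebra_simps)
qed

text \<open>The smooth upper bound is applied pathwise and then averaged. Orthogonality of the noise
  turns the linear term into \<open>- G k\<close>.\<close>

lemma f_step:
  assumes f: "integrable P (\<lambda>w. f (x k w))"
  shows "integrable P (\<lambda>w. f (x (Suc k) w))"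
    and "expectation (\<lambda>w. f (x (Suc k) w)) \<le> expectation (\<lambda>w. f (x k w)) - \<alpha> (Suc k) * G k
      + L / 2 * (\<alpha> (Suc k))\<^sup>2 * ((1 + V) * G k + M)"
proof -
  define a where "a = \<alpha> (Suc k)"
  define d where "d w = \<xi> (Suc k) w - g k w" for w
  define u where "u w = f (x k w) + a * (g k w \<bullet> d w) + L / 2 * a\<^sup>2 * (norm (d w))\<^sup>2" for w
  note g = gradient_square_integrable[OF f]
  note \<xi> = noise_moment(1)[OF g]
  have d: "square_integrable P d"
    and d_moment: "expectation (\<lambda>w. (norm (d w))\<^sup>2) \<le> (1 + V) * G k + M"
    using increment_moment[OF g] by (simp_all add: d_def[abs_def])
  have u: "integrable P u"
    unfolding u_def[abs_def]
    using f square_integrable_inner[OF g d] square_integrable_norm[OF d] by simp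
  have le_u: "f (x (Suc k) w) \<le> u w" if "w \<in> space P" for w
  proof -
    have "x (Suc k) w - x k w = a *\<^sub>R d w"
      using sgd[OF that, of k] by (simp add: a_def d_def algebra_simps)
    then show ?thesis
      using smooth_upper_bound[OF gradient L_smooth, of "x (Suc k) w" "x k w"]
      by (simp add: u_def power_mult_distrib mult.assoc)
  qed
  \<comment> \<open>The new value lies between the constant \<open>f xstar\<close> and the
    integrable \<open>u\<close>.\<close>
  show int: "integrable P (\<lambda>w. f (x (Suc k) w))"
  proof (rule Bochner_Integration.integrable_bound)
    show "integrable P (\<lambda>w. \<bar>f xstar\<bar> + \<bar>u w\<bar>)" using u by simp
    show "AE w in P. norm (f (x (Suc k) w)) \<le> norm (\<bar>f xstar\<bar> + \<bar>u w\<bar>)"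
    proof (rule AE_I2)
      fix w assume "w \<in> space P"
      then show "norm (f (x (Suc k) w)) \<le> norm (\<bar>f xstar\<bar> + \<bar>u w\<bar>)"
        using le_u[of w] minimizer[of "x (Suc k) w"] by simp
    qed
  qed measurable
  have "expectation (\<lambda>w. g k w \<bullet> d w) = - G k"
    using square_integrable_norm[OF g] square_integrable_inner[OF g \<xi>]
      noise_orthogonal[OF g_measurable_F g \<xi>]
    by (simp add: d_def inner_diff_right power2_norm_eq_inner)
  then have "expectation u = expectation (\<lambda>w. f (x k w)) - a * G k
      + L / 2 * a\<^sup>2 * expectation (\<lambda>w. (norm (d w))\<^sup>2)"
    unfolding u_def[abs_def]
    using f square_integrable_inner[OF g d] square_integrable_norm[OF d] by simp
  also have "\<dots> \<le> expectation (\<lambda>w. f (x k w)) - a * G k + L / 2 * a\<^sup>2 * ((1 + V) * G k + M)"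
    using d_moment L_pos by (intro add_left_mono mult_left_mono) auto
  finally show "expectation (\<lambda>w. f (x (Suc k) w)) \<le> expectation (\<lambda>w. f (x k w))
      - \<alpha> (Suc k) * G k + L / 2 * (\<alpha> (Suc k))\<^sup>2 * ((1 + V) * G k + M)"
    using integral_mono[OF int u le_u] by (simp add: a_def)
qed

section \<open>Integrability along the iteration and distances to reference points\<close>

lemma f_integrable: "integrable P (\<lambda>w. f (x k w))"
  by (induction k) (use x0_integrable f_step(1) in auto)

lemmas g_square_integrable = gradient_square_integrable[OF f_integrable]

lemma expectation_f_ge: "f xstar \<le> expectation (\<lambda>w. f (x k w))"
  using integral_mono[of P "\<lambda>w. f xstar" "\<lambda>w. f (x k w)"] f_integrable minimizer
  by (simp add: prob_space)

lemma G_le: "G k \<le> 2 * L * (expectation (\<lambda>w. f (x k w)) - f xstar)"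
proof -
  have "G k \<le> expectation (\<lambda>w. 2 * L * (f (x k w) - f xstar))"
    using square_integrable_norm[OF g_square_integrable] f_integrable
    by (intro integral_mono smooth_gradient_bound[OF gradient L_smooth L_pos minimizer]) auto
  also have "\<dots> = 2 * L * (expectation (\<lambda>w. f (x k w)) - f xstar)"
    using f_integrable by (simp add: prob_space)
  finally show ?thesis .
qed

text \<open>The iterates may fail to be square integrable, but their increments are not affected by
  this, so the property passes from the distance at time \<open>p\<close> to all later
  distances.\<close>

lemma distance_square_integrable:
  assumes "square_integrable P (\<lambda>w. x p w - z w)" "p \<le> k"
  shows "square_integrable P (\<lambda>w. x k w - z w)"
  using assms(2)
proof (induction k rule: dec_induct)
  case base
  show ?case by (rule assms(1))
next
  case (step k)
  note d = increment_moment(1)[OF g_square_integrable[of k]]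
  have "square_integrable P (\<lambda>w. (x k w - z w) + \<alpha> (Suc k) *\<^sub>R (\<xi> (Suc k) w - g k w))"
    by (intro square_integrable_add square_integrable_scaleR step.IH d)
  then show ?case
    by (subst square_integrable_cong) (auto simp: sgd algebra_simps)
qed

lemma expected_gap_le:
  assumes z: "square_integrable P (\<lambda>w. x k w - z w)" and fz: "integrable P (\<lambda>w. f (z w))"
  shows "expectation (\<lambda>w. f (x k w)) - expectation (\<lambda>w. f (z w))
    \<le> expectation (\<lambda>w. g k w \<bullet> (x k w - z w))"
proof -
  have "expectation (\<lambda>w. f (x k w) - f (z w)) \<le> expectation (\<lambda>w. g k w \<bullet> (x k w - z w))"
    using fz f_integrable square_integrable_inner[OF g_square_integrable z]
    by (intro integral_mono convex_on_gradient[OF gradient convex]) auto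
  then show ?thesis using fz f_integrable by simp
qed

text \<open>Expand the square. Since \<open>z\<close> is known at time \<open>k\<close>, the noise
  is orthogonal to \<open>x k - z\<close>, and convexity bounds the remaining cross term with the
  gradient. A random \<open>z\<close> is allowed so that earlier iterates can serve as reference
  points.\<close>

lemma distance_step:
  assumes zF: "z \<in> borel_measurable (F k)" and fz: "integrable P (\<lambda>w. f (z w))"
    and z: "square_integrable P (\<lambda>w. x k w - z w)"
  shows "expectation (\<lambda>w. (norm (x (Suc k) w - z w))\<^sup>2) \<le> expectation (\<lambda>w. (norm (x k w - z w))\<^sup>2)
    - 2 * \<alpha> (Suc k) * (expectation (\<lambda>w. f (x k w)) - expectation (\<lambda>w. f (z w)))
    + (\<alpha> (Suc k))\<^sup>2 * ((1 + V) * G k + M)"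
proof -
  define a where "a = \<alpha> (Suc k)"
  define d where "d w = \<xi> (Suc k) w - g k w" for w
  note g = g_square_integrable[of k]
  note \<xi> = noise_moment(1)[OF g]
  have d: "square_integrable P d"
    and d_moment: "expectation (\<lambda>w. (norm (d w))\<^sup>2) \<le> (1 + V) * G k + M"
    using increment_moment[OF g] by (simp_all add: d_def[abs_def])
  have "(\<lambda>w. x k w - z w) \<in> borel_measurable (F k)"
    using x_measurable_F zF by measurable
  then have "expectation (\<lambda>w. (x k w - z w) \<bullet> d w) = - expectation (\<lambda>w. g k w \<bullet> (x k w - z w))"
    using square_integrable_inner[OF z \<xi>] square_integrable_inner[OF z g]
      noise_orthogonal[OF _ z \<xi>]
    by (simp add: d_def inner_diff_right[of _ "\<xi> (Suc k) _"] inner_commute[of "g k _"])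
  moreover have "expectation (\<lambda>w. (norm (x (Suc k) w - z w))\<^sup>2)
      = expectation (\<lambda>w. (norm (x k w - z w))\<^sup>2 + 2 * a * ((x k w - z w) \<bullet> d w) + a\<^sup>2 * (norm (d w))\<^sup>2)"
  proof (rule Bochner_Integration.integral_cong[OF refl])
    fix w assume "w \<in> space P"
    then have "x (Suc k) w - z w = (x k w - z w) + a *\<^sub>R d w"
      using sgd[of w k] by (simp add: a_def d_def algebra_simps)
    then show "(norm (x (Suc k) w - z w))\<^sup>2
        = (norm (x k w - z w))\<^sup>2 + 2 * a * ((x k w - z w) \<bullet> d w) + a\<^sup>2 * (norm (d w))\<^sup>2"
      by (simp add: power2_norm_eq_inner inner_add_left inner_add_right inner_commute
          algebra_simps power2_eq_square[of a])
  qed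
  ultimately have "expectation (\<lambda>w. (norm (x (Suc k) w - z w))\<^sup>2)
      = expectation (\<lambda>w. (norm (x k w - z w))\<^sup>2)
        - 2 * a * expectation (\<lambda>w. g k w \<bullet> (x k w - z w)) + a\<^sup>2 * expectation (\<lambda>w. (norm (d w))\<^sup>2)"
    using square_integrable_norm[OF z] square_integrable_inner[OF z d] square_integrable_norm[OF d]
    by simp
  also have "\<dots> \<le> expectation (\<lambda>w. (norm (x k w - z w))\<^sup>2)
      - 2 * a * (expectation (\<lambda>w. f (x k w)) - expectation (\<lambda>w. f (z w)))
      + a\<^sup>2 * ((1 + V) * G k + M)"
    using d_moment step_nonneg[of k] expected_gap_le[OF z fz]
    by (intro add_mono diff_mono mult_left_mono) (auto simp: a_def)
  finally show ?thesis by (simp add: a_def)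
qed

lemma gap_squared_le:
  assumes z: "square_integrable P (\<lambda>w. x k w - z w)" and fz: "integrable P (\<lambda>w. f (z w))"
    and le: "expectation (\<lambda>w. f (z w)) \<le> expectation (\<lambda>w. f (x k w))"
  shows "(expectation (\<lambda>w. f (x k w)) - expectation (\<lambda>w. f (z w)))\<^sup>2
    \<le> G k * expectation (\<lambda>w. (norm (x k w - z w))\<^sup>2)"
proof -
  \<comment> \<open>By \<open>le\<close> the gap is nonnegative, so the convexity inequality may be
    squared.\<close>
  have "(expectation (\<lambda>w. f (x k w)) - expectation (\<lambda>w. f (z w)))\<^sup>2
      \<le> (expectation (\<lambda>w. g k w \<bullet> (x k w - z w)))\<^sup>2"
    using expected_gap_le[OF z fz] le by (intro power_mono) auto
  also have "\<dots> \<le> G k * expectation (\<lambda>w. (norm (x k w - z w))\<^sup>2)"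
    by (rule integral_inner_Cauchy_Schwarz[OF g_square_integrable z])
  finally show ?thesis .
qed

text \<open>Since \<open>x 0\<close> need not be square integrable, \<open>xstar\<close> itself is not an admissible reference
  point; it is replaced by \<open>x 0\<close> where \<open>x 0\<close> is large.\<close>

lemma almost_optimal_reference:
  assumes "\<epsilon> > 0"
  obtains z where "z \<in> borel_measurable (F 0)" "integrable P (\<lambda>w. f (z w))"
    "square_integrable P (\<lambda>w. x 0 w - z w)" "expectation (\<lambda>w. f (z w)) \<le> f xstar + \<epsilon>"
proof -
  define z where "z R w = (if norm (x 0 w) \<le> real R then xstar else x 0 w)" for R :: nat and w
  have zF: "z R \<in> borel_measurable (F 0)" for R
  proof -
    note [measurable] = x_measurable_F[of 0]
    show ?thesis unfolding z_def[abs_def] by measurable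
  qed
  have z_meas [measurable]: "z R \<in> borel_measurable P" for R
    by (rule measurable_from_subalg[OF subalgebra_F zF])
  have bound: "\<bar>f (z R w)\<bar> \<le> \<bar>f xstar\<bar> + \<bar>f (x 0 w)\<bar>" for R w
    by (simp add: z_def)
  have dominating: "integrable P (\<lambda>w. \<bar>f xstar\<bar> + \<bar>f (x 0 w)\<bar>)"
    using x0_integrable by simp
  have fz: "integrable P (\<lambda>w. f (z R w))" for R
    by (rule Bochner_Integration.integrable_bound[OF dominating]) (use bound in auto)
  \<comment> \<open>The difference vanishes where \<open>x 0\<close> is large and is bounded
    elsewhere.\<close>
  have dist: "square_integrable P (\<lambda>w. x 0 w - z R w)" for R
  proof (rule square_integrable_bounded_norm)
    show "integrable P (\<lambda>w. (real R + norm xstar)\<^sup>2)" by simp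
    fix w
    show "(norm (x 0 w - z R w))\<^sup>2 \<le> (real R + norm xstar)\<^sup>2"
      using norm_triangle_ineq4[of "x 0 w" xstar] by (auto simp: z_def intro!: power_mono)
  qed measurable
  \<comment> \<open>For each \<open>w\<close> the sequence is eventually constant, namely once
    \<open>R\<close> exceeds the norm of \<open>x 0 w\<close>, and \<open>f (x 0)\<close> supplies
    the dominating function.\<close>
  have "(\<lambda>R. expectation (\<lambda>w. f (z R w))) \<longlonglongrightarrow> expectation (\<lambda>w. f xstar)"
  proof (rule integral_dominated_convergence[OF _ _ dominating])
    have "(\<lambda>R. f (z R w)) \<longlonglongrightarrow> f xstar" for w
    proof (rule tendsto_eventually)
      obtain N :: nat where "norm (x 0 w) \<le> real N" using real_arch_simple by blast
      then show "eventually (\<lambda>R. f (z R w) = f xstar) sequentially"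
        unfolding z_def eventually_sequentially by (intro exI[of _ N]) auto
    qed
    then show "AE w in P. (\<lambda>R. f (z R w)) \<longlonglongrightarrow> f xstar" by simp
  qed (use bound in auto)
  then have "eventually (\<lambda>R. expectation (\<lambda>w. f (z R w)) < f xstar + \<epsilon>) sequentially"
    using assms by (intro order_tendstoD(2)) (auto simp: prob_space)
  then obtain R where "expectation (\<lambda>w. f (z R w)) < f xstar + \<epsilon>"
    by (auto simp: eventually_sequentially)
  then show thesis using that[OF zF fz dist, of R] by simp
qed

end

section \<open>From the stochastic estimates to the deterministic recursion\<close>

theorem theorem2:
  fixes P :: "'w measure"
    and f :: "real ^ 'd \<Rightarrow> real"
    and grad_f :: "real ^ 'd \<Rightarrow> real ^ 'd"
    and xstar :: "real ^ 'd"
    and L M V :: real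
    and \<alpha> :: "nat \<Rightarrow> real"
    and x \<xi> :: "nat \<Rightarrow> 'w \<Rightarrow> real ^ 'd"
  assumes "prob_space P"
    and gradient: "\<And>y. GDERIV f y :> grad_f y"
    and grad_cont: "continuous_on UNIV grad_f"
    and convex: "convex_on UNIV f"
    and L_pos: "L > 0"
    and L_smooth: "\<And>y z. norm (grad_f y - grad_f z) \<le> L * norm (y - z)"
    and lower_bound: "bdd_below (range f)"
    and minimizer: "\<And>y. f xstar \<le> f y"
    and step_pos: "\<And>k. k \<ge> 1 \<Longrightarrow> \<alpha> k > 0"
    and step_null: "\<alpha> \<longlonglongrightarrow> 0"
    and step_diverges: "filterlim (\<lambda>n. \<Sum>k=1..n. \<alpha> k) at_top sequentially"
    and step_squares: "(\<lambda>n. \<alpha> n * (\<Sum>k=1..n. (\<alpha> k)\<^sup>2)) \<longlonglongrightarrow> 0"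
    and x0_rv: "x 0 \<in> borel_measurable P"
    and x0_integrable: "integrable P (\<lambda>w. f (x 0 w))"
    and noise_rv: "\<And>k. k \<ge> 1 \<Longrightarrow> \<xi> k \<in> borel_measurable P"
    and sgd: "\<And>k w. k \<ge> 1 \<Longrightarrow> w \<in> space P \<Longrightarrow>
        x k w = x (k - 1) w - \<alpha> k *\<^sub>R grad_f (x (k - 1) w) + \<alpha> k *\<^sub>R \<xi> k w"
    and M_nonneg: "M \<ge> 0"
    and V_nonneg: "V \<ge> 0"
    and noise_mean: "\<And>k. k \<ge> 1 \<Longrightarrow>
        AE w in P. vec_cond_exp P (noise_filtration P (x 0) \<xi> (k - 1)) (\<xi> k) w = 0"
    and noise_second_moment: "\<And>k. k \<ge> 1 \<Longrightarrow>
        AE w in P. nn_cond_exp P (noise_filtration P (x 0) \<xi> (k - 1))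
            (\<lambda>v. ennreal ((norm (\<xi> k v))\<^sup>2)) w
          \<le> ennreal (M + V * (norm (grad_f (x (k - 1) w)))\<^sup>2)"
  shows "(\<forall>n. integrable P (\<lambda>w. f (x n w))) \<and>
    (\<lambda>n. \<integral>w. f (x n w) \<partial>P) \<longlonglongrightarrow> f xstar"
proof -
  interpret prob_space P by fact
  interpret S: convex_sgd P f grad_f xstar L M V \<alpha> x \<xi>
  proof unfold_locales
    show "continuous_on UNIV grad_f" "convex_on UNIV f" "L > 0" "M \<ge> 0" "V \<ge> 0"
      "x 0 \<in> borel_measurable P" "integrable P (\<lambda>w. f (x 0 w))"
      by fact+
    show "GDERIV f y :> grad_f y" "f xstar \<le> f y"
      "norm (grad_f y - grad_f z) \<le> L * norm (y - z)" for y z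
      by (rule gradient minimizer L_smooth)+
    show "\<xi> k \<in> borel_measurable P" if "k \<ge> 1" for k
      by (rule noise_rv[OF that])
    fix k
    show "\<alpha> (Suc k) \<ge> 0" using step_pos[of "Suc k"] by simp
    show "AE w in P. vec_cond_exp P (noise_filtration P (x 0) \<xi> k) (\<xi> (Suc k)) w = 0"
      using noise_mean[of "Suc k"] by simp
    show "AE w in P. nn_cond_exp P (noise_filtration P (x 0) \<xi> k)
          (\<lambda>v. ennreal ((norm (\<xi> (Suc k) v))\<^sup>2)) w
        \<le> ennreal (M + V * (norm (grad_f (x k w)))\<^sup>2)"
      using noise_second_moment[of "Suc k"] by simp
    fix w assume "w \<in> space P"
    then show "x (Suc k) w = x k w - \<alpha> (Suc k) *\<^sub>R grad_f (x k w) + \<alpha> (Suc k) *\<^sub>R \<xi> (Suc k) w"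
      using sgd[of "Suc k" w] by simp
  qed
  \<comment> \<open>At time \<open>p\<close> the difference is zero, which starts the propagation of
    square integrability.\<close>
  have xx: "square_integrable P (\<lambda>w. x k w - x p w)" if "p \<le> k" for p k
    using that by (rule S.distance_square_integrable[rotated]) (simp add: square_integrable_def)
  interpret R: sgd_recursion "\<lambda>k. expectation (\<lambda>w. f (x k w)) - f xstar" S.G \<alpha>
    "\<lambda>p k. expectation (\<lambda>w. (norm (x k w - x p w))\<^sup>2)" L M V
  proof unfold_locales
    fix p k :: nat
    show "0 \<le> expectation (\<lambda>w. f (x k w)) - f xstar" using S.expectation_f_ge by simp
    show "expectation (\<lambda>w. f (x (Suc k) w)) - f xstar
        \<le> expectation (\<lambda>w. f (x k w)) - f xstar - \<alpha> (Suc k) * S.G k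
          + L / 2 * (\<alpha> (Suc k))\<^sup>2 * ((1 + V) * S.G k + M)"
      using S.f_step(2)[OF S.f_integrable, of k] by simp
    assume "p \<le> k"
    show "expectation (\<lambda>w. (norm (x (Suc k) w - x p w))\<^sup>2)
        \<le> expectation (\<lambda>w. (norm (x k w - x p w))\<^sup>2)
          - 2 * \<alpha> (Suc k) * (expectation (\<lambda>w. f (x k w)) - f xstar
              - (expectation (\<lambda>w. f (x p w)) - f xstar))
          + (\<alpha> (Suc k))\<^sup>2 * ((1 + V) * S.G k + M)"
      using S.distance_step[OF S.measurable_F_mono[OF S.x_measurable_F \<open>p \<le> k\<close>]
          S.f_integrable xx[OF \<open>p \<le> k\<close>]]
      by simp
    assume "expectation (\<lambda>w. f (x p w)) - f xstar \<le> expectation (\<lambda>w. f (x k w)) - f xstar"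
    then show "(expectation (\<lambda>w. f (x k w)) - f xstar - (expectation (\<lambda>w. f (x p w)) - f xstar))\<^sup>2
        \<le> S.G k * expectation (\<lambda>w. (norm (x k w - x p w))\<^sup>2)"
      using S.gap_squared_le[OF xx[OF \<open>p \<le> k\<close>] S.f_integrable] by simp
  next
    fix \<epsilon> :: real assume "\<epsilon> > 0"
    then obtain z where z: "z \<in> borel_measurable (S.F 0)" "integrable P (\<lambda>w. f (z w))"
        "square_integrable P (\<lambda>w. x 0 w - z w)" "expectation (\<lambda>w. f (z w)) \<le> f xstar + \<epsilon>"
      by (rule S.almost_optimal_reference)
    show "\<exists>Q. (\<forall>k. 0 \<le> Q k) \<and> (\<forall>k. Q (Suc k) \<le> Q k
          - 2 * \<alpha> (Suc k) * (expectation (\<lambda>w. f (x k w)) - f xstar - \<epsilon>)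
          + (\<alpha> (Suc k))\<^sup>2 * ((1 + V) * S.G k + M))"
    \<comment> \<open>The witness is the mean squared distance to \<open>z\<close>. Replacing the
      expectation of \<open>f z\<close> by \<open>f xstar + \<epsilon>\<close> only weakens the
      drift.\<close>
    proof (intro exI[of _ "\<lambda>k. expectation (\<lambda>w. (norm (x k w - z w))\<^sup>2)"] conjI allI)
      fix k
      have "2 * \<alpha> (Suc k) * (expectation (\<lambda>w. f (x k w)) - f xstar - \<epsilon>)
          \<le> 2 * \<alpha> (Suc k) * (expectation (\<lambda>w. f (x k w)) - expectation (\<lambda>w. f (z w)))"
        using z(4) step_pos[of "Suc k"] by (intro mult_left_mono) auto
      then show "expectation (\<lambda>w. (norm (x (Suc k) w - z w))\<^sup>2)
          \<le> expectation (\<lambda>w. (norm (x k w - z w))\<^sup>2)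
            - 2 * \<alpha> (Suc k) * (expectation (\<lambda>w. f (x k w)) - f xstar - \<epsilon>)
            + (\<alpha> (Suc k))\<^sup>2 * ((1 + V) * S.G k + M)"
        using S.distance_step[OF S.measurable_F_mono[OF z(1) le0] z(2)
            S.distance_square_integrable[OF z(3) le0], of k]
        by simp
    qed simp
  qed (use assms S.G_le in auto)
  have "(\<lambda>n. expectation (\<lambda>w. f (x n w)) - f xstar + f xstar) \<longlonglongrightarrow> 0 + f xstar"
    by (intro tendsto_add R.suboptimality_tendsto_0 tendsto_const)
  then show ?thesis using S.f_integrable by simp
qed

end
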